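(* For any integers $1\leq m<n<\infty$, $$d_{\mathrm{GH}}(\mathbb{S}^m,\mathbb{S}^n)\geq \nu_{m,n}:=\frac{\pi}{2}-\mathrm{cov}_{\mathbb{S}^m}(n+1).$$
   Context: For an integer $m\ge 0$, $\mathbb{S}^m=\{x\in\mathbb{R}^{m+1}:\|x\|=1\}$ is the unit sphere with the geodesic distance $d_{\mathbb{S}^m}(x,x')=\arccos\langle x,x'\rangle$. For an integer $k\ge1$ and a compact metric space $X$, the $k$-th covering radius is $\mathrm{cov}_X(k):=\inf\{d_{\mathrm{H}}(X,P): P\subset X,\ |P|\leq k\}$ ($P$ nonempty), with $d_{\mathrm{H}}$ the Hausdorff distance. The Gromov-Hausdorff distance between bounded metric spaces $X,Y$ is $d_{\mathrm{GH}}(X,Y)=\inf d_{\mathrm{H}}(f(X),g(Y))$, the infimum being over all metric spaces $Z$ and all isometric (distance-preserving) embeddings $f:X\to Z$, $g:Y\to Z$. Equivalently $d_{\mathrm{GH}}(X,Y)=\frac12\inf_R \operatorname{dis}(R)$, where $R\subseteq X\times Y$ ranges over correspondences (relations whose projections to $X$ and to $Y$ are both surjective) and $\operatorname{dis}(R)=\sup_{(x,y),(x',y')\in R}|d_X(x,x')-d_Y(y,y')|$. *)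

theory Defs
  imports "HOL-Analysis.Analysis"
begin

text \<open>Metric spaces are given as in the locale \<^locale>\<open>Metric_space\<close>, by a carrier set and
  a real-valued distance function of which only the values on the carrier matter.\<close>

definition geodesic :: "nat \<Rightarrow> (nat \<Rightarrow> real) \<Rightarrow> (nat \<Rightarrow> real) \<Rightarrow> real" where
  "geodesic m x y = arccos (\<Sum>i\<le>m. x i * y i)"

text \<open>The unit sphere of dimension \<open>m\<close> is the underlying set of the library's \<^const>\<open>nsphere\<close>;
  points of the \<open>(m+1)\<close>-dimensional space are functions on \<open>nat\<close> vanishing beyond \<open>m\<close>.\<close>

abbreviation unit_sphere :: "nat \<Rightarrow> (nat \<Rightarrow> real) set" where
  "unit_sphere m \<equiv> topspace (nsphere m)"

lemma unit_sphere_eq: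
  "unit_sphere m = {x. L2_set x {..m} = 1 \<and> (\<forall>i>m. x i = 0)}"
  by (auto simp: nsphere L2_set_def)

text \<open>For nonempty sets at bounded distance from each other; on such sets all suprema and infima
  below are those of nonempty bounded sets of reals.\<close>

definition hausdorff_distance :: "('a \<Rightarrow> 'a \<Rightarrow> real) \<Rightarrow> 'a set \<Rightarrow> 'a set \<Rightarrow> real" where
  "hausdorff_distance d A B =
     max (SUP a\<in>A. INF b\<in>B. d a b) (SUP b\<in>B. INF a\<in>A. d a b)"

definition covering_radius :: "'a set \<Rightarrow> ('a \<Rightarrow> 'a \<Rightarrow> real) \<Rightarrow> nat \<Rightarrow> real" where
  "covering_radius X d k =
     Inf {hausdorff_distance d X P | P. P \<subseteq> X \<and> P \<noteq> {} \<and> finite P \<and> card P \<le> k}"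

definition isometric_embedding ::
  "'a set \<Rightarrow> ('a \<Rightarrow> 'a \<Rightarrow> real) \<Rightarrow> 'c set \<Rightarrow> ('c \<Rightarrow> 'c \<Rightarrow> real) \<Rightarrow> ('a \<Rightarrow> 'c) \<Rightarrow> bool" where
  "isometric_embedding X dX Z dZ f \<longleftrightarrow>
     f ` X \<subseteq> Z \<and> (\<forall>x\<in>X. \<forall>x'\<in>X. dZ (f x) (f x') = dX x x')"

text \<open>The infimum is meant over all metric spaces \<open>Z\<close>. As a definition cannot quantify over types,
  \<open>Z\<close> ranges over the metric spaces whose carrier is a set of type \<open>('a + 'b) set\<close>. Nothing is lost:
  only \<open>f ` X \<union> g ` Y\<close> matters, and it injects into \<open>'a + 'b\<close>; see
  \<open>gromov_hausdorff_ambient_space\<close> below.\<close>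

definition gromov_hausdorff ::
  "'a set \<Rightarrow> ('a \<Rightarrow> 'a \<Rightarrow> real) \<Rightarrow> 'b set \<Rightarrow> ('b \<Rightarrow> 'b \<Rightarrow> real) \<Rightarrow> real" where
  "gromov_hausdorff X dX Y dY =
     Inf {hausdorff_distance dZ (f ` X) (g ` Y) | (Z :: ('a + 'b) set) dZ f g.
            Metric_space Z dZ \<and> isometric_embedding X dX Z dZ f \<and> isometric_embedding Y dY Z dZ g}"

lemma gromov_hausdorff_ambient_space:
  fixes X :: "'a set" and Y :: "'b set" and Z :: "'c set"
  assumes Z: "Metric_space Z dZ"
    and f: "isometric_embedding X dX Z dZ f" and g: "isometric_embedding Y dY Z dZ g"
  shows "\<exists>(Z' :: ('a + 'b) set) dZ' f' g'. Metric_space Z' dZ' \<and>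
           isometric_embedding X dX Z' dZ' f' \<and> isometric_embedding Y dY Z' dZ' g' \<and>
           hausdorff_distance dZ' (f' ` X) (g' ` Y) = hausdorff_distance dZ (f ` X) (g ` Y)"
proof -
  interpret Metric_space Z dZ by (rule Z)
  define W where "W = f ` X \<union> g ` Y"
  define h :: "'c \<Rightarrow> 'a + 'b" where
    "h z = (if z \<in> f ` X then Inl (inv_into X f z) else Inr (inv_into Y g z))" for z
  define k where "k = inv_into W h"
  define d' where "d' p q = dZ (k p) (k q)" for p q
  have WZ: "W \<subseteq> Z"
    using f g by (auto simp: W_def isometric_embedding_def)
  have "inj_on h W"
    by (rule inj_onI) (auto simp: h_def W_def split: if_splits dest: inv_into_injective)
  then have kh: "k (h z) = z" if "z \<in> W" for z
    using that by (simp add: k_def)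
  have kf: "k (h (f x)) = f x" if "x \<in> X" for x
    using that by (intro kh) (auto simp: W_def)
  have kg: "k (h (g y)) = g y" if "y \<in> Y" for y
    using that by (intro kh) (auto simp: W_def)
  have "Metric_space (h ` W) d'"
  proof
    show "d' p q = 0 \<longleftrightarrow> p = q" if "p \<in> h ` W" "q \<in> h ` W" for p q
      using that WZ by (auto simp: d'_def kh subset_iff)
    show "d' p r \<le> d' p q + d' q r" if "p \<in> h ` W" "q \<in> h ` W" "r \<in> h ` W" for p q r
      using that WZ by (auto simp: d'_def kh subset_iff intro!: triangle)
  qed (auto simp: d'_def commute)
  moreover have "isometric_embedding X dX (h ` W) d' (h \<circ> f)"
    using f by (auto simp: isometric_embedding_def W_def d'_def kf)
  moreover have "isometric_embedding Y dY (h ` W) d' (h \<circ> g)"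
    using g by (auto simp: isometric_embedding_def W_def d'_def kg)
  moreover have "hausdorff_distance d' ((h \<circ> f) ` X) ((h \<circ> g) ` Y) =
      hausdorff_distance dZ (f ` X) (g ` Y)"
    by (simp add: hausdorff_distance_def image_image d'_def kf kg cong: image_cong_simp)
  ultimately show ?thesis by blast
qed

end

theory Submission
  imports Defs "HOL-Homology.Invariance_of_Domain"
begin

text \<open>
  The bound expresses that the larger sphere cannot be cut into \<open>n + 1\<close> pieces free of nearly
  antipodal points, while the smaller one can be covered by \<open>n + 1\<close> balls of small radius.

  Embed both spheres isometrically into a metric space \<open>Z\<close>, at Hausdorff distance \<open>H\<close>, and let
  \<open>P\<close> be a set of at most \<open>n + 1\<close> points of the \<open>m\<close>-sphere, at Hausdorff distance \<open>r\<close> from it. To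
  each point \<open>y\<close> of the \<open>n\<close>-sphere choose a point \<open>\<phi> y\<close> of the \<open>m\<close>-sphere at distance about \<open>H\<close> in
  \<open>Z\<close>, and put \<open>y\<close> into a class named by a point of \<open>P\<close> that is at distance about \<open>r\<close> from
  \<open>\<phi> y\<close>. Two points of one class are then at distance at most about \<open>2 * H + 2 * r\<close>. By the
  Lusternik-Schnirelmann theorem one of the at most \<open>n + 1\<close> classes contains points whose distance
  is arbitrarily close to \<open>pi\<close>, whence \<open>H + r \<ge> pi / 2\<close> (\<open>hausdorff_distance_spheres_ge\<close>).
  As \<open>\<phi>\<close> need not be continuous, the classes are arbitrary sets; this is why the theorem is
  needed in the approximate form \<open>Lusternik_Schnirelmann_approximate\<close>.

  That theorem follows from the Borsuk-Ulam theorem, applied to the differences of the distances of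
  \<open>x\<close> and \<open>-x\<close> from the first \<open>n\<close> sets. These functions are Lipschitz for arbitrary sets, so
  Borsuk-Ulam is only needed for Lipschitz maps. It comes from the fact that
  an odd map of a sphere to itself has odd degree (\<open>Borsuk_odd_degree_Lipschitz\<close>): an odd map
  without zeros from the \<open>n\<close>-sphere to the \<open>n\<close>-dimensional space would give an odd self-map of the
  \<open>n\<close>-sphere whose image lies in the equator, and such a map has degree \<open>0\<close>.

  The oddness of the degree is proved by induction on the dimension. The induction step is
  \<open>Borsuk_odd_mapping_degree_step\<close>, which compares the degree of an odd map with that of its
  restriction to the equator, provided that the equator is mapped to itself. To reach this position,
  the map is deformed through odd maps without zeros, which is possible once some line through the
  origin misses the image of the equator. For a Lipschitz map such a line exists by counting
  (\<open>odd_Lipschitz_misses_line\<close>): a Lipschitz image of a bounded set of dimension \<open>d\<close> is too thin to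
  meet all points of a fine grid of dimension \<open>d + 1\<close>.
\<close>

section \<open>Unit spheres\<close>

lemma unit_sphere_abs_le_1:
  assumes "x \<in> unit_sphere n"
  shows "\<bar>x i\<bar> \<le> 1"
proof (cases "i \<le> n")
  case True
  have "(x i)\<^sup>2 \<le> (\<Sum>j\<le>n. (x j)\<^sup>2)"
    using True by (intro member_le_sum) auto
  also have "\<dots> = 1"
    using assms by (simp add: nsphere)
  finally show ?thesis
    by (simp add: abs_square_le_1)
qed (use assms in \<open>auto simp: nsphere\<close>)

lemma unit_sphere_uminus: "x \<in> unit_sphere n \<Longrightarrow> (\<lambda>i. - x i) \<in> unit_sphere n"
  by (auto simp: nsphere)

lemma unit_sphere_mono:
  assumes "m \<le> n"
  shows "unit_sphere m \<subseteq> unit_sphere n"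
proof
  fix x assume x: "x \<in> unit_sphere m"
  have "(\<Sum>i\<le>n. (x i)\<^sup>2) = (\<Sum>i\<le>m. (x i)\<^sup>2)"
    using assms x by (intro sum.mono_neutral_right) (auto simp: nsphere)
  then show "x \<in> unit_sphere n"
    using assms x by (auto simp: nsphere)
qed

lemma nsphere_eq_top_of_set: "nsphere n = top_of_set (unit_sphere n)"
  by (simp add: nsphere euclidean_product_topology)

lemma compact_unit_sphere: "compact (unit_sphere n)"
proof -
  have "compactin (powertop_real UNIV) (PiE UNIV (\<lambda>i::nat. {-1..1::real}))"
    by (simp add: compactin_PiE)
  then have "compact (PiE UNIV (\<lambda>i::nat. {-1..1::real}))"
    by (simp add: euclidean_product_topology)
  moreover have "closed (unit_sphere n)"
  proof -
    have "unit_sphere n = {x. (\<Sum>i\<le>n. (x i)\<^sup>2) = 1} \<inter> (\<Inter>i\<in>{n<..}. {x. x i = 0})"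
      by (auto simp: nsphere)
    moreover have "closed {x. (\<Sum>i\<le>n. (x i)\<^sup>2) = (1::real)}"
      by (intro closed_Collect_eq continuous_intros continuous_on_product_coordinates)
    moreover have "closed {x::nat \<Rightarrow> real. x i = 0}" for i
      by (intro closed_Collect_eq continuous_intros continuous_on_product_coordinates)
    ultimately show ?thesis by (auto intro!: closed_Int closed_INT)
  qed
  moreover have "unit_sphere n \<subseteq> PiE UNIV (\<lambda>i::nat. {-1..1::real})"
    using unit_sphere_abs_le_1 by (fastforce simp: abs_le_iff)
  ultimately show ?thesis
    by (metis compact_Int_closed inf.absorb_iff2)
qed

text \<open>Lipschitz conditions are stated with respect to the \<open>l\<^sup>1\<close> norm, in which they can be checked
  one coordinate at a time.\<close>

definition l1_dist :: "nat \<Rightarrow> (nat \<Rightarrow> real) \<Rightarrow> (nat \<Rightarrow> real) \<Rightarrow> real" where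
  "l1_dist n x y = (\<Sum>j\<le>n. \<bar>x j - y j\<bar>)"

lemma l1_dist_nonneg: "0 \<le> l1_dist n x y"
  by (simp add: l1_dist_def sum_nonneg)

lemma L2_set_diff_le_l1_dist: "\<bar>L2_set x {..n} - L2_set y {..n}\<bar> \<le> l1_dist n x y"
proof -
  have *: "L2_set x {..n} \<le> L2_set y {..n} + l1_dist n x y" for x y
  proof -
    have "L2_set (\<lambda>i. y i + (x i - y i)) {..n} \<le> L2_set y {..n} + L2_set (\<lambda>i. x i - y i) {..n}"
      by (rule L2_set_triangle_ineq)
    also have "L2_set (\<lambda>i. x i - y i) {..n} \<le> l1_dist n x y"
      unfolding l1_dist_def by (rule L2_set_le_sum_abs)
    finally show ?thesis by simp
  qed
  have "l1_dist n x y = l1_dist n y x"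
    by (simp add: l1_dist_def abs_minus_commute)
  then show ?thesis using *[of x y] *[of y x] by linarith
qed

lemma continuous_map_nsphere_Lipschitz:
  assumes "\<And>x y. \<lbrakk>x \<in> unit_sphere n; y \<in> unit_sphere n\<rbrakk> \<Longrightarrow> \<bar>f x - f y\<bar> \<le> L * l1_dist n x y"
  shows "continuous_map (nsphere n) euclideanreal f"
proof -
  let ?S = "unit_sphere n"
  have "continuous_on ?S f"
    unfolding continuous_on_def
  proof
    fix x assume x: "x \<in> ?S"
    have "((\<lambda>y. L * l1_dist n y x) \<longlongrightarrow> L * l1_dist n x x) (at x within ?S)"
    proof -
      have "continuous_on ?S (\<lambda>y. L * l1_dist n y x)"
        unfolding l1_dist_def
        by (intro continuous_intros continuous_on_subset[OF continuous_on_product_coordinates]) auto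
      then show ?thesis using x by (simp add: continuous_on_def)
    qed
    then have "((\<lambda>y. L * l1_dist n y x) \<longlongrightarrow> 0) (at x within ?S)"
      by (simp add: l1_dist_def)
    moreover have "\<forall>\<^sub>F y in at x within ?S. norm (f y - f x) \<le> L * l1_dist n y x"
      using assms x by (auto simp: eventually_at_filter)
    ultimately have "((\<lambda>y. f y - f x) \<longlongrightarrow> 0) (at x within ?S)"
      by (rule Lim_null_comparison[rotated])
    then show "(f \<longlongrightarrow> f x) (at x within ?S)"
      by (simp add: LIM_zero_iff)
  qed
  then show ?thesis
    by (metis continuous_map_iff_continuous nsphere_eq_top_of_set)
qed

section \<open>Lines missed by a Lipschitz map\<close>

text \<open>The pigeonhole principle in place of measure theory. The points of a grid of mesh \<open>1 / q\<close> in a unit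
  cube with \<open>n + 2\<close> coordinates number \<open>q ^ (n + 2)\<close>. Points of \<open>Y\<close> in the same cell of side
  \<open>1 / (c * q)\<close> of the box of the first \<open>n + 1\<close> coordinates have images closer than the mesh, so each
  cell accounts for at most one grid point. There are only about \<open>(2 * t * c * q) ^ (n + 1)\<close> cells,
  which is too few when \<open>q\<close> is large. The hypothesis on \<open>H\<close> is a Lipschitz condition relative to
  the coordinates \<open>p\<close>; these are kept separate from \<open>Y\<close> so that \<open>Y\<close> can consist of polar
  coordinates.\<close>

lemma box_image_misses_cube:
  fixes p H :: "'a \<Rightarrow> nat \<Rightarrow> real"
  assumes box: "\<And>y j. \<lbrakk>y \<in> Y; j \<le> n\<rbrakk> \<Longrightarrow> \<bar>p y j\<bar> \<le> T"
    and lip: "\<And>y y' h i. \<lbrakk>y \<in> Y; y' \<in> Y; h > 0; \<And>j. j \<le> n \<Longrightarrow> \<bar>p y j - p y' j\<bar> \<le> h; i \<le> Suc n\<rbrakk>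
                 \<Longrightarrow> \<bar>H y i - H y' i\<bar> \<le> C * h"
  shows "\<exists>v. (\<forall>i\<le>Suc n. 1 \<le> v i \<and> v i \<le> 2) \<and> (\<forall>y\<in>Y. \<exists>i\<le>Suc n. H y i \<noteq> v i)"
proof -
  obtain c :: nat where c: "C < real c" "c \<ge> 1"
    by (meson less_le_trans max.cobounded1 max.cobounded2 of_nat_mono reals_Archimedean2)
  obtain t :: nat where t: "T < real t" "t \<ge> 1"
    by (meson less_le_trans max.cobounded1 max.cobounded2 of_nat_mono reals_Archimedean2)
  \<comment> \<open>any \<open>q\<close> larger than this power makes the final count fail\<close>
  define q where "q = (3 * t * c) ^ Suc n + 1"
  have "q > 0" by (simp add: q_def)
  define V where "V g i = 1 + real (g i) / real q" for g :: "nat \<Rightarrow> nat" and i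
  define G where "G = PiE {..Suc n} (\<lambda>_. {..<q})"
  define K where "K = int (t * c * q)"
  have "\<exists>g\<in>G. \<forall>y\<in>Y. \<exists>i\<le>Suc n. H y i \<noteq> V g i"
  proof (rule ccontr)
    assume "\<not> ?thesis"
    then have "\<forall>g\<in>G. \<exists>y\<in>Y. \<forall>i\<le>Suc n. H y i = V g i" by auto
    then obtain Yg where Yg: "\<And>g. g \<in> G \<Longrightarrow> Yg g \<in> Y"
        "\<And>g i. \<lbrakk>g \<in> G; i \<le> Suc n\<rbrakk> \<Longrightarrow> H (Yg g) i = V g i"
      by metis
    define cell where "cell g = restrict (\<lambda>j. \<lfloor>real (c * q) * p (Yg g) j\<rfloor>) {..n}" for g
    have "inj_on cell G"
    proof (rule inj_onI)
      fix g g' assume g: "g \<in> G" "g' \<in> G" and eq: "cell g = cell g'"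
      have close: "\<bar>p (Yg g) j - p (Yg g') j\<bar> \<le> 1 / real (c * q)" if "j \<le> n" for j
      proof -
        have "\<lfloor>real (c * q) * p (Yg g) j\<rfloor> = \<lfloor>real (c * q) * p (Yg g') j\<rfloor>"
          using fun_cong[OF eq, of j] that by (simp add: cell_def)
        then have "\<bar>real (c * q) * p (Yg g) j - real (c * q) * p (Yg g') j\<bar> \<le> 1"
          by linarith
        then have "real (c * q) * \<bar>p (Yg g) j - p (Yg g') j\<bar> \<le> 1"
          by (simp add: abs_mult flip: right_diff_distrib)
        then show ?thesis
          using c \<open>q > 0\<close> by (simp add: field_simps)
      qed
      show "g = g'"
      proof (rule PiE_ext[OF g[unfolded G_def]])
        fix i assume "i \<in> {..Suc n}"
        then have i: "i \<le> Suc n" by simp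
        have "\<bar>V g i - V g' i\<bar> \<le> C * (1 / real (c * q))"
          using lip[of "Yg g" "Yg g'" "1 / real (c * q)" i] Yg g i close c \<open>q > 0\<close> by simp
        also have "\<dots> < 1 / real q"
          using c \<open>q > 0\<close> by (simp add: field_simps)
        finally have "\<bar>real (g i) - real (g' i)\<bar> / real q < 1 / real q"
          using \<open>q > 0\<close> by (simp add: V_def flip: diff_divide_distrib)
        then show "g i = g' i"
          using \<open>q > 0\<close> by (simp add: divide_less_cancel)
      qed
    qed
    moreover have "cell ` G \<subseteq> PiE {..n} (\<lambda>_. {-K..K})"
    proof (rule image_subsetI)
      fix g assume g: "g \<in> G"
      have "\<lfloor>real (c * q) * p (Yg g) j\<rfloor> \<in> {-K..K}" if "j \<le> n" for j
      proof -
        have "\<bar>real (c * q) * p (Yg g) j\<bar> \<le> real (c * q) * real t"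
          unfolding abs_mult using box[OF Yg(1)[OF g] that] t by (intro mult_mono) auto
        then have "- real (t * c * q) \<le> real (c * q) * p (Yg g) j" "real (c * q) * p (Yg g) j \<le> real (t * c * q)"
          by (auto simp: algebra_simps abs_le_iff)
        then show ?thesis
          unfolding K_def by (simp add: le_floor_iff floor_le_iff)
      qed
      then show "cell g \<in> PiE {..n} (\<lambda>_. {-K..K})"
        by (auto simp: cell_def)
    qed
    moreover have cardK: "card {-K..K} = 2 * (t * c * q) + 1"
    proof -
      have "card {- int N..int N} = 2 * N + 1" for N
        unfolding card_atLeastAtMost_int by linarith
      then show ?thesis by (simp only: K_def)
    qed
    ultimately have "card G \<le> card (PiE {..n} (\<lambda>_. {-K..K}))"
      by (intro card_inj_on_le[of cell]) (auto intro!: finite_PiE)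
    then have "q ^ (n + 2) \<le> (2 * (t * c * q) + 1) ^ (n + 1)"
      unfolding G_def by (simp only: cardK card_PiE finite_atMost prod_constant card_atMost card_lessThan Suc_eq_plus1 add.assoc one_add_one)
    also have "\<dots> \<le> (3 * t * c * q) ^ (n + 1)"
      using t c \<open>q > 0\<close> by (intro power_mono) (auto simp: Suc_le_eq)
    also have "\<dots> = (3 * t * c) ^ (n + 1) * q ^ (n + 1)"
      by (rule power_mult_distrib)
    finally have "q * q ^ (n + 1) \<le> (3 * t * c) ^ (n + 1) * q ^ (n + 1)"
      by simp
    then have "q \<le> (3 * t * c) ^ (n + 1)"
      using \<open>q > 0\<close> by (simp only: mult_le_cancel2) simp
    then show False
      by (simp add: q_def)
  qed
  then obtain g where g: "g \<in> G" "\<And>y. y \<in> Y \<Longrightarrow> \<exists>i\<le>Suc n. H y i \<noteq> V g i"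
    by blast
  have "1 \<le> V g i \<and> V g i \<le> 2" if "i \<le> Suc n" for i
  proof -
    have "g i < q" using g(1) that by (auto simp: G_def)
    then show ?thesis using \<open>q > 0\<close> by (simp add: V_def field_simps)
  qed
  then show ?thesis using g(2) by blast
qed

text \<open>The cone over the image of \<open>F\<close> is the image of the points \<open>t * x\<close> of the solid ball under
  \<open>t * x \<mapsto> t * F x\<close>. This map is Lipschitz again, since \<open>t\<close> is the norm of \<open>t * x\<close>, and its domain
  has one dimension less than its target. As \<open>F\<close> is bounded away from \<open>0\<close> by compactness, the
  bounded cone \<open>t \<le> T\<close> contains every point of the cube \<open>[1, 2] ^ (n + 2)\<close> that lies on a
  positive ray through the image. The cube therefore has a point on no such ray; by oddness the
  opposite ray is missed as well. Its last coordinate is nonzero, so it can be scaled to \<open>1\<close>.\<close>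

lemma odd_Lipschitz_misses_line:
  fixes F :: "(nat \<Rightarrow> real) \<Rightarrow> nat \<Rightarrow> real"
  assumes lip: "\<And>x y i. \<lbrakk>x \<in> unit_sphere n; y \<in> unit_sphere n; i \<le> Suc n\<rbrakk>
                  \<Longrightarrow> \<bar>F x i - F y i\<bar> \<le> L * l1_dist n x y"
    and odd: "\<And>x i. \<lbrakk>x \<in> unit_sphere n; i \<le> Suc n\<rbrakk> \<Longrightarrow> F (\<lambda>i. - x i) i = - F x i"
    and nz: "\<And>x. x \<in> unit_sphere n \<Longrightarrow> \<exists>i\<le>Suc n. F x i \<noteq> 0"
  obtains v where "v (Suc n) = 1" and "\<And>x c. x \<in> unit_sphere n \<Longrightarrow> \<exists>i\<le>Suc n. F x i \<noteq> c * v i"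
proof -
  let ?S = "unit_sphere n"
  have Sne: "?S \<noteq> {}" using in_topspace_nsphere by auto
  have cont: "continuous_on ?S (\<lambda>x. F x i)" if "i \<le> Suc n" for i
  proof -
    have "continuous_map (nsphere n) euclideanreal (\<lambda>x. F x i)"
      by (rule continuous_map_nsphere_Lipschitz[of n _ L]) (use lip that in auto)
    then show ?thesis
      by (metis continuous_map_iff_continuous nsphere_eq_top_of_set)
  qed
  define N where "N x = (\<Sum>i\<le>Suc n. \<bar>F x i\<bar>)" for x
  have contN: "continuous_on ?S N"
    unfolding N_def by (intro continuous_intros cont) auto
  obtain a where a: "a \<in> ?S" "\<And>x. x \<in> ?S \<Longrightarrow> N a \<le> N x"
    using continuous_attains_inf[OF compact_unit_sphere Sne contN] by blast
  obtain b where b: "b \<in> ?S" "\<And>x. x \<in> ?S \<Longrightarrow> N x \<le> N b"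
    using continuous_attains_sup[OF compact_unit_sphere Sne contN] by blast
  have Npos: "N a > 0"
  proof -
    obtain i where "i \<le> Suc n" "F a i \<noteq> 0" using nz[OF a(1)] by blast
    then show ?thesis unfolding N_def by (intro sum_pos2[of _ i]) auto
  qed
  have FM: "\<bar>F x i\<bar> \<le> N b" if "x \<in> ?S" "i \<le> Suc n" for x i
  proof -
    have "\<bar>F x i\<bar> \<le> N x" unfolding N_def using that(2) by (intro member_le_sum) auto
    then show ?thesis using b(2)[OF that(1)] by linarith
  qed
  have Lnn: "\<bar>F x i - F y i\<bar> \<le> \<bar>L\<bar> * l1_dist n x y" if "x \<in> ?S" "y \<in> ?S" "i \<le> Suc n" for x y i
  proof -
    have "L * l1_dist n x y \<le> \<bar>L\<bar> * l1_dist n x y"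
      by (intro mult_right_mono) (auto simp: l1_dist_def sum_nonneg)
    then show ?thesis using lip[OF that] by linarith
  qed
  define d where "d = real (Suc n)"
  define T where "T = 2 * (d + 1) / N a"
  define Y where "Y = {0..T} \<times> ?S"
  define p where "p y j = fst y * snd y j" for y :: "real \<times> (nat \<Rightarrow> real)" and j :: nat
  define H where "H y i = fst y * F (snd y) i" for y :: "real \<times> (nat \<Rightarrow> real)" and i :: nat
  define C where "C = \<bar>L\<bar> * (d + d * d) + d * N b"
  have d: "d \<ge> 1" by (simp add: d_def)
  have "\<bar>p y j\<bar> \<le> T" if "y \<in> Y" for y j
  proof -
    have "\<bar>fst y * snd y j\<bar> \<le> T * 1"
      unfolding abs_mult using that unit_sphere_abs_le_1
      by (intro mult_mono) (auto simp: Y_def T_def)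
    then show ?thesis by (simp add: p_def)
  qed
  moreover have "\<bar>H y i - H y' i\<bar> \<le> C * h"
    if y: "y \<in> Y" "y' \<in> Y" and h: "h > 0" "\<And>j. j \<le> n \<Longrightarrow> \<bar>p y j - p y' j\<bar> \<le> h" and i: "i \<le> Suc n"
    for y y' h i
  proof -
    obtain t x where yt: "y = (t, x)" "t \<ge> 0" "x \<in> ?S" using y by (auto simp: Y_def)
    obtain t' x' where yt': "y' = (t', x')" "t' \<ge> 0" "x' \<in> ?S" using y by (auto simp: Y_def)
    have hj: "\<bar>t * x j - t' * x' j\<bar> \<le> h" if "j \<le> n" for j
      using h(2)[OF that] by (simp add: p_def yt yt')
    have "L2_set (\<lambda>j. t * x j) {..n} = t" "L2_set (\<lambda>j. t' * x' j) {..n} = t'"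
      using yt yt' by (auto simp: unit_sphere_eq simp flip: L2_set_right_distrib)
    then have "\<bar>t - t'\<bar> \<le> l1_dist n (\<lambda>j. t * x j) (\<lambda>j. t' * x' j)"
      by (metis L2_set_diff_le_l1_dist)
    also have "\<dots> \<le> d * h"
      unfolding l1_dist_def d_def using sum_bounded_above[of "{..n}" "\<lambda>j. \<bar>t * x j - t' * x' j\<bar>" h] hj by simp
    finally have tt: "\<bar>t - t'\<bar> \<le> d * h" .
    have "t * l1_dist n x x' = (\<Sum>j\<le>n. \<bar>t * x j - t * x' j\<bar>)"
      unfolding l1_dist_def sum_distrib_left using yt
      by (intro sum.cong) (auto simp: abs_mult simp flip: right_diff_distrib)
    also have "\<dots> \<le> (\<Sum>j\<le>n. h + d * h)"
    proof (rule sum_mono)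
      fix j assume "j \<in> {..n}"
      have "\<bar>t' * x' j - t * x' j\<bar> \<le> (d * h) * 1"
        unfolding left_diff_distrib[symmetric] abs_mult
        using tt unit_sphere_abs_le_1[OF yt'(3)] h(1) d
        by (intro mult_mono) (auto simp: abs_minus_commute)
      then show "\<bar>t * x j - t * x' j\<bar> \<le> h + d * h"
        using hj[of j] \<open>j \<in> {..n}\<close> by auto
    qed
    also have "\<dots> = (d + d * d) * h"
      by (simp add: d_def algebra_simps)
    finally have tl: "t * l1_dist n x x' \<le> (d + d * d) * h" .
    have "\<bar>t * F x i - t * F x' i\<bar> = t * \<bar>F x i - F x' i\<bar>"
      using yt by (simp add: abs_mult flip: right_diff_distrib)
    also have "\<dots> \<le> t * (\<bar>L\<bar> * l1_dist n x x')"
      using yt yt' Lnn i by (intro mult_left_mono) auto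
    also have "\<dots> = \<bar>L\<bar> * (t * l1_dist n x x')" by simp
    also have "\<dots> \<le> \<bar>L\<bar> * ((d + d * d) * h)"
      by (intro mult_left_mono tl) auto
    finally have 1: "\<bar>t * F x i - t * F x' i\<bar> \<le> \<bar>L\<bar> * ((d + d * d) * h)" .
    have 2: "\<bar>t * F x' i - t' * F x' i\<bar> \<le> (d * h) * N b"
      unfolding left_diff_distrib[symmetric] abs_mult
      using tt FM[OF yt'(3) i] h(1) d by (intro mult_mono) auto
    have "C * h = \<bar>L\<bar> * ((d + d * d) * h) + (d * h) * N b"
      by (simp add: C_def algebra_simps)
    then show ?thesis
      using 1 2 by (simp add: H_def yt yt')
  qed
  ultimately have "\<exists>v. (\<forall>i\<le>Suc n. 1 \<le> v i \<and> v i \<le> 2) \<and> (\<forall>y\<in>Y. \<exists>i\<le>Suc n. H y i \<noteq> v i)"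
    by (rule box_image_misses_cube[of Y n p T H C])
  then obtain v where v: "\<And>i. i \<le> Suc n \<Longrightarrow> 1 \<le> v i \<and> v i \<le> 2"
      "\<And>y. y \<in> Y \<Longrightarrow> \<exists>i\<le>Suc n. H y i \<noteq> v i"
    by blast
  \<comment> \<open>the bound \<open>T\<close> is chosen so that \<open>F x = c * v\<close> forces \<open>1 / c \<le> T\<close>\<close>
  have pos: "\<exists>i\<le>Suc n. F x i \<noteq> c * v i" if x: "x \<in> ?S" and "c > 0" for x c
  proof (rule ccontr)
    assume "\<not> ?thesis"
    then have eq: "\<And>i. i \<le> Suc n \<Longrightarrow> F x i = c * v i" by auto
    have "N a \<le> N x" using a x by blast
    also have "N x \<le> (\<Sum>i\<le>Suc n. c * 2)"
      unfolding N_def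
    proof (rule sum_mono)
      fix i assume "i \<in> {..Suc n}"
      then have "F x i = c * v i" "1 \<le> v i" "v i \<le> 2" using eq v(1) by auto
      then show "\<bar>F x i\<bar> \<le> c * 2" using \<open>c > 0\<close> by (simp add: abs_mult)
    qed
    also have "\<dots> = 2 * (d + 1) * c" by (simp add: d_def algebra_simps)
    finally have "1 / c \<le> T"
      using \<open>c > 0\<close> Npos by (simp add: T_def field_simps)
    then have "(1 / c, x) \<in> Y" using x \<open>c > 0\<close> by (simp add: Y_def)
    then obtain i where "i \<le> Suc n" "F x i / c \<noteq> v i"
      using v(2)[of "(1 / c, x)"] by (auto simp: H_def)
    then show False using eq \<open>c > 0\<close> by auto
  qed
  have line: "\<exists>i\<le>Suc n. F x i \<noteq> c * v i" if x: "x \<in> ?S" for x c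
  proof -
    consider "c > 0" | "c = 0" | "c < 0" by linarith
    then show ?thesis
    proof cases
      case 3
      then obtain i where "i \<le> Suc n" "F (\<lambda>i. - x i) i \<noteq> (- c) * v i"
        using pos[OF unit_sphere_uminus[OF x], of "- c"] by auto
      then show ?thesis using odd[OF x] by (intro exI[of _ i]) auto
    qed (use pos nz x in auto)
  qed
  show ?thesis
  proof (rule that[of "\<lambda>i. v i / v (Suc n)"])
    show "v (Suc n) / v (Suc n) = 1" using v(1)[of "Suc n"] by simp
    show "\<exists>i\<le>Suc n. F x i \<noteq> c * (v i / v (Suc n))" if "x \<in> ?S" for x c
      using line[OF that, of "c / v (Suc n)"] by simp
  qed
qed

section \<open>The degree of odd maps\<close>

text \<open>Only the coordinates up to \<open>k\<close> count. So maps into the space of dimension \<open>k + 1\<close> can be given by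
  functions that are arbitrary beyond \<open>k\<close>.\<close>

definition radial_projection :: "nat \<Rightarrow> (nat \<Rightarrow> real) \<Rightarrow> nat \<Rightarrow> real" where
  "radial_projection k y i = (if i \<le> k then y i / L2_set y {..k} else 0)"

lemma radial_projection_in_sphere:
  assumes "\<exists>i\<le>k. y i \<noteq> 0"
  shows "radial_projection k y \<in> unit_sphere k"
proof -
  have "L2_set y {..k} > 0"
    using assms L2_set_nonneg[of y "{..k}"] by (auto simp: L2_set_eq_0_iff less_le)
  moreover have "L2_set (radial_projection k y) {..k} = L2_set (\<lambda>i. inverse (L2_set y {..k}) * y i) {..k}"
    by (rule L2_set_cong) (auto simp: radial_projection_def divide_inverse mult.commute)
  ultimately show ?thesis
    by (simp add: unit_sphere_eq radial_projection_def flip: L2_set_right_distrib)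
qed

lemma radial_projection_Suc:
  assumes "y (Suc k) = 0"
  shows "radial_projection (Suc k) y = radial_projection k y"
  using assms
  by (auto simp: radial_projection_def fun_eq_iff L2_set_def atMost_Suc le_Suc_eq)

lemma radial_projection_cong:
  "(\<And>i. i \<le> k \<Longrightarrow> y i = z i) \<Longrightarrow> radial_projection k y = radial_projection k z"
  by (auto simp: radial_projection_def fun_eq_iff cong: L2_set_cong_simp)

lemma radial_projection_uminus: "radial_projection k (\<lambda>i. - y i) = (\<lambda>i. - radial_projection k y i)"
  by (auto simp: radial_projection_def L2_set_def fun_eq_iff)

lemma continuous_map_radial_projection:
  assumes "\<And>i. i \<le> k \<Longrightarrow> continuous_map X euclideanreal (\<lambda>x. F x i)"
    and "\<And>x. x \<in> topspace X \<Longrightarrow> \<exists>i\<le>k. F x i \<noteq> 0"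
  shows "continuous_map X (nsphere k) (\<lambda>x. radial_projection k (F x))"
proof -
  have "continuous_map X euclideanreal (\<lambda>x. radial_projection k (F x) i)" for i
  proof (cases "i \<le> k")
    case True
    have "L2_set (F x) {..k} \<noteq> 0" if "x \<in> topspace X" for x
      using assms(2)[OF that] by (auto simp: L2_set_eq_0_iff)
    then show ?thesis
      using True assms(1) unfolding radial_projection_def L2_set_def
      by (auto intro!: continuous_intros simp: L2_set_def)
  qed (simp add: radial_projection_def)
  moreover have "radial_projection k (F x) \<in> unit_sphere k" if "x \<in> topspace X" for x
    by (intro radial_projection_in_sphere assms(2) that)
  ultimately show ?thesis
    by (auto simp: nsphere continuous_map_in_subtopology continuous_map_componentwise_UNIV)
qed

lemma degree_radial_projection_homotopic:
  assumes cont: "\<And>i. i \<le> k \<Longrightarrow> continuous_map (prod_topology (top_of_set {0..1::real}) (nsphere k))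
                    euclideanreal (\<lambda>(s, x). H s x i)"
    and nz: "\<And>s x. \<lbrakk>0 \<le> s; s \<le> 1; x \<in> unit_sphere k\<rbrakk> \<Longrightarrow> \<exists>i\<le>k. H s x i \<noteq> 0"
  shows "Brouwer_degree2 k (\<lambda>x. radial_projection k (H 0 x)) =
         Brouwer_degree2 k (\<lambda>x. radial_projection k (H 1 x))"
proof (rule Brouwer_degree2_homotopic)
  have "continuous_map (prod_topology (top_of_set {0..1::real}) (nsphere k)) (nsphere k)
          (\<lambda>z. radial_projection k (case z of (s, x) \<Rightarrow> H s x))"
    using cont nz by (intro continuous_map_radial_projection) (auto simp: case_prod_unfold)
  then show "homotopic_with (\<lambda>x. True) (nsphere k) (nsphere k)
      (\<lambda>x. radial_projection k (H 0 x)) (\<lambda>x. radial_projection k (H 1 x))"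
    unfolding homotopic_with_def
    by (intro exI[of _ "\<lambda>z. radial_projection k (case z of (s, x) \<Rightarrow> H s x)"]) auto
qed

lemma unit_sphere_0:
  assumes "x \<in> unit_sphere 0"
  obtains "x = (\<lambda>i. if i = 0 then 1 else 0)" | "x = (\<lambda>i. - (if i = 0 then 1 else 0))"
proof -
  have x0: "x 0 = 1 \<or> x 0 = -1" and xi: "\<And>i. i > 0 \<Longrightarrow> x i = 0"
    using assms by (auto simp: nsphere power2_eq_1_iff)
  from x0 show ?thesis
  proof
    assume "x 0 = 1"
    then show ?thesis using xi by (intro that(1)) auto
  next
    assume "x 0 = -1"
    then show ?thesis using xi by (intro that(2)) auto
  qed
qed

text \<open>Up to sign, an odd self-map of the two-point sphere is the identity.\<close>

lemma degree_of_odd_map_0: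
  assumes odd: "\<And>x. x \<in> unit_sphere 0 \<Longrightarrow> F (\<lambda>i. - x i) 0 = - F x 0"
    and nz: "\<And>x. x \<in> unit_sphere 0 \<Longrightarrow> F x 0 \<noteq> 0"
  shows "\<bar>Brouwer_degree2 0 (\<lambda>x. radial_projection 0 (F x))\<bar> = 1"
proof -
  define e :: "nat \<Rightarrow> real" where "e = (\<lambda>i. if i = 0 then 1 else 0)"
  have e: "e \<in> unit_sphere 0"
    using in_topspace_nsphere by (simp add: e_def)
  have rp: "radial_projection 0 y = (\<lambda>i. if i = 0 then sgn (y 0) else 0)" for y
    by (auto simp: radial_projection_def fun_eq_iff L2_set_def real_sgn_eq)
  consider "F e 0 > 0" | "F e 0 < 0"
    using nz[OF e] by linarith
  then show ?thesis
  proof cases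
    case 1
    have "radial_projection 0 (F x) = id x" if "x \<in> unit_sphere 0" for x
      using that by (rule unit_sphere_0) (use 1 odd[OF e] in \<open>auto simp: rp e_def sgn_if intro!: ext\<close>)
    then have "Brouwer_degree2 0 (\<lambda>x. radial_projection 0 (F x)) = Brouwer_degree2 0 id"
      by (rule Brouwer_degree2_eq)
    then show ?thesis by simp
  next
    case 2
    have "radial_projection 0 (F x) = (\<lambda>i. if i = 0 then - x i else x i)" if "x \<in> unit_sphere 0" for x
      using that by (rule unit_sphere_0) (use 2 odd[OF e] in \<open>auto simp: rp e_def sgn_if intro!: ext\<close>)
    then have "Brouwer_degree2 0 (\<lambda>x. radial_projection 0 (F x)) =
        Brouwer_degree2 0 (\<lambda>x i. if i = 0 then - x i else x i)"
      by (rule Brouwer_degree2_eq)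
    then show ?thesis by (simp add: Brouwer_degree2_reflection)
  qed
qed

text \<open>Let \<open>v\<close> span a line that misses the image of the equator, with last coordinate \<open>1\<close>. The homotopy
  subtracts from \<open>F x\<close> the multiple \<open>s * (1 - \<bar>x (Suc k)\<bar>) * F x (Suc k)\<close> of \<open>v\<close>. The factor
  \<open>1 - \<bar>x (Suc k)\<bar>\<close> is even, so that the map remains odd. It is \<open>1\<close> on the equator, where at
  \<open>s = 1\<close> the last coordinate is cancelled. It is smaller elsewhere, so that off the equator the
  last coordinate can only become \<open>0\<close> where \<open>F x (Suc k)\<close> is, and there nothing is subtracted; on
  the equator a zero would put \<open>F x\<close> on the line. Hence the degree does not change, and at
  \<open>s = 1\<close> the equator is mapped to itself by a map that is again odd, Lipschitz and without zeros.\<close>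

theorem Borsuk_odd_degree_Lipschitz:
  assumes lip: "\<And>x y i. \<lbrakk>x \<in> unit_sphere k; y \<in> unit_sphere k; i \<le> k\<rbrakk>
                  \<Longrightarrow> \<bar>F x i - F y i\<bar> \<le> L * l1_dist k x y"
    and odd: "\<And>x i. \<lbrakk>x \<in> unit_sphere k; i \<le> k\<rbrakk> \<Longrightarrow> F (\<lambda>i. - x i) i = - F x i"
    and nz: "\<And>x. x \<in> unit_sphere k \<Longrightarrow> \<exists>i\<le>k. F x i \<noteq> 0"
  shows "odd (Brouwer_degree2 k (\<lambda>x. radial_projection k (F x)))"
  using assms
proof (induction k arbitrary: F L)
  case 0
  have "\<bar>Brouwer_degree2 0 (\<lambda>x. radial_projection 0 (F x))\<bar> = 1"
    using 0(2,3) by (intro degree_of_odd_map_0) auto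
  then show ?case by (metis dvd_abs_iff odd_one)
next
  case (Suc k)
  let ?S = "unit_sphere (Suc k)" and ?E = "unit_sphere k"
  have ES: "?E \<subseteq> ?S" by (intro unit_sphere_mono) simp
  have pole0: "x (Suc k) = 0" if "x \<in> ?E" for x
    using that by (simp add: nsphere)
  have l1E: "l1_dist (Suc k) x y = l1_dist k x y" if "x \<in> ?E" "y \<in> ?E" for x y
    using pole0[OF that(1)] pole0[OF that(2)] by (simp add: l1_dist_def)
  have lipE: "\<bar>F x i - F y i\<bar> \<le> L * l1_dist k x y" if "x \<in> ?E" "y \<in> ?E" "i \<le> Suc k" for x y i
    using Suc.prems(1)[of x y i] that ES l1E[of x y] by auto
  obtain v where v: "v (Suc k) = 1" "\<And>x c. x \<in> ?E \<Longrightarrow> \<exists>i\<le>Suc k. F x i \<noteq> c * v i"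
  proof (rule odd_Lipschitz_misses_line[of k F L])
    show "F (\<lambda>i. - x i) i = - F x i" if "x \<in> ?E" "i \<le> Suc k" for x i
      using Suc.prems(2)[of x i] that ES by auto
    show "\<exists>i\<le>Suc k. F x i \<noteq> 0" if "x \<in> ?E" for x
      using Suc.prems(3)[of x] that ES by auto
  next
    fix w :: "nat \<Rightarrow> real"
    assume "w (Suc k) = 1" "\<And>x c. x \<in> ?E \<Longrightarrow> \<exists>i\<le>Suc k. F x i \<noteq> c * w i"
    then show ?thesis by (rule that)
  qed (rule lipE)
  define H where "H s x i = F x i - s * (1 - \<bar>x (Suc k)\<bar>) * F x (Suc k) * v i" for s :: real and x i
  have H_nz: "\<exists>i\<le>Suc k. H s x i \<noteq> 0" if s: "0 \<le> s" "s \<le> 1" and x: "x \<in> ?S" for s x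
  proof (rule ccontr)
    assume contra: "\<not> ?thesis"
    have eq: "F x i = s * (1 - \<bar>x (Suc k)\<bar>) * F x (Suc k) * v i" if "i \<le> Suc k" for i
    proof -
      have "H s x i = 0" using contra that by blast
      then show ?thesis unfolding H_def by linarith
    qed
    have "F x (Suc k) \<noteq> 0"
    proof -
      obtain i where "i \<le> Suc k" "F x i \<noteq> 0"
        using Suc.prems(3)[OF x] by blast
      then show ?thesis using eq[of i] by auto
    qed
    then have "s * (1 - \<bar>x (Suc k)\<bar>) = 1"
      using eq[of "Suc k"] v(1) by simp
    moreover have "s * (1 - \<bar>x (Suc k)\<bar>) \<le> 1 * (1 - \<bar>x (Suc k)\<bar>)"
      using s unit_sphere_abs_le_1[OF x] by (intro mult_right_mono) auto
    ultimately have "x (Suc k) = 0" by simp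
    then have "x \<in> ?E"
      using topspace_nsphere_minus1[OF x] by simp
    then obtain i where "i \<le> Suc k" "F x i \<noteq> s * (1 - \<bar>x (Suc k)\<bar>) * F x (Suc k) * v i"
      using v(2) by blast
    then show False
      using eq by blast
  qed
  have contF: "continuous_map (nsphere (Suc k)) euclideanreal (\<lambda>x. F x i)" if "i \<le> Suc k" for i
    by (rule continuous_map_nsphere_Lipschitz[of _ _ L]) (use Suc.prems(1) that in auto)
  have H0: "H 0 x = F x" for x by (rule ext) (simp add: H_def)
  define G where "G = (\<lambda>x. radial_projection (Suc k) (H 1 x))"
  have "Brouwer_degree2 (Suc k) (\<lambda>x. radial_projection (Suc k) (H 0 x)) =
        Brouwer_degree2 (Suc k) (\<lambda>x. radial_projection (Suc k) (H 1 x))"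
  proof (rule degree_radial_projection_homotopic)
    let ?P = "prod_topology (top_of_set {0..1::real}) (nsphere (Suc k))"
    have 1: "continuous_map ?P euclideanreal fst"
      using continuous_map_fst continuous_map_into_fulltopology by blast
    have 2: "continuous_map ?P euclideanreal (\<lambda>z. F (snd z) i)" if "i \<le> Suc k" for i
      using continuous_map_compose[OF continuous_map_snd contF[OF that]] by (simp add: o_def)
    have 3: "continuous_map ?P euclideanreal (\<lambda>z. snd z (Suc k))"
      using continuous_map_compose[OF continuous_map_snd continuous_map_nsphere_projection]
      by (simp add: o_def)
    show "continuous_map ?P euclideanreal (\<lambda>(s, x). H s x i)" if "i \<le> Suc k" for i
      unfolding H_def case_prod_unfold
      using that by (intro continuous_intros continuous_map_real_abs 1 2 3) auto
  qed (use H_nz in auto)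
  then have "Brouwer_degree2 (Suc k) (\<lambda>x. radial_projection (Suc k) (F x)) = Brouwer_degree2 (Suc k) G"
    by (simp only: H0 G_def)
  moreover have "even (Brouwer_degree2 (Suc k) G - Brouwer_degree2 (Suc k - Suc 0) G)"
  proof (rule Borsuk_odd_mapping_degree_step)
    show "continuous_map (nsphere (Suc k)) (nsphere (Suc k)) G"
      unfolding G_def
    proof (rule continuous_map_radial_projection)
      show "continuous_map (nsphere (Suc k)) euclideanreal (\<lambda>x. H 1 x i)" if "i \<le> Suc k" for i
        unfolding H_def using that
        by (intro continuous_intros continuous_map_real_abs contF continuous_map_nsphere_projection) auto
    qed (use H_nz in auto)
    show "(G \<circ> (\<lambda>x i. - x i)) u = ((\<lambda>x i. - x i) \<circ> G) u" if "u \<in> ?S" for u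
    proof -
      have "radial_projection (Suc k) (H 1 (\<lambda>i. - u i)) = radial_projection (Suc k) (\<lambda>i. - H 1 u i)"
        using Suc.prems(2)[OF that] by (intro radial_projection_cong) (simp add: H_def algebra_simps)
      then show ?thesis
        by (simp add: G_def radial_projection_uminus)
    qed
    show "G \<in> unit_sphere (Suc k - Suc 0) \<rightarrow> unit_sphere (Suc k - Suc 0)"
    proof
      fix x assume "x \<in> unit_sphere (Suc k - Suc 0)"
      then have x: "x \<in> ?E" by simp
      have "G x \<in> ?S"
        unfolding G_def using x ES by (intro radial_projection_in_sphere H_nz) auto
      moreover have "G x (Suc k) = 0"
        using v(1) pole0[OF x] by (simp add: G_def H_def radial_projection_def)
      ultimately show "G x \<in> unit_sphere (Suc k - Suc 0)"
        using topspace_nsphere_minus1 by blast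
    qed
  qed
  moreover have "odd (Brouwer_degree2 k G)"
  proof -
    define K where "K = (\<Sum>i\<le>k. \<bar>v i\<bar>)"
    have "odd (Brouwer_degree2 k (\<lambda>x. radial_projection k (H 1 x)))"
    proof (rule Suc.IH[of _ "L * (1 + K)"])
      show "\<bar>H 1 x i - H 1 y i\<bar> \<le> L * (1 + K) * l1_dist k x y"
        if "x \<in> ?E" "y \<in> ?E" "i \<le> k" for x y i
      proof -
        have vK: "\<bar>v i\<bar> \<le> K"
          unfolding K_def using that by (intro member_le_sum) auto
        have "\<bar>(F x (Suc k) - F y (Suc k)) * v i\<bar> \<le> (L * l1_dist k x y) * K"
          unfolding abs_mult using lipE[OF that(1,2)] vK
          by (intro mult_mono) (auto intro: order_trans[OF abs_ge_zero])
        moreover have "\<bar>F x i - F y i\<bar> \<le> L * l1_dist k x y"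
          using lipE[OF that(1,2)] that by simp
        moreover have "H 1 x i - H 1 y i = (F x i - F y i) - (F x (Suc k) - F y (Suc k)) * v i"
          using pole0[OF that(1)] pole0[OF that(2)] by (simp add: H_def algebra_simps)
        ultimately show ?thesis by (simp add: algebra_simps)
      qed
      show "H 1 (\<lambda>i. - x i) i = - H 1 x i" if "x \<in> ?E" "i \<le> k" for x i
        using Suc.prems(2)[of x] that ES by (auto simp: H_def algebra_simps)
      show "\<exists>i\<le>k. H 1 x i \<noteq> 0" if "x \<in> ?E" for x
      proof -
        have "H 1 x (Suc k) = 0" using v(1) pole0[OF that] by (simp add: H_def)
        then show ?thesis using H_nz[of 1 x] that ES by (auto simp: le_Suc_eq)
      qed
    qed
    moreover have "Brouwer_degree2 k G = Brouwer_degree2 k (\<lambda>x. radial_projection k (H 1 x))"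
    proof (rule Brouwer_degree2_eq)
      fix x assume "x \<in> ?E"
      then show "G x = radial_projection k (H 1 x)"
        unfolding G_def using v(1) pole0 by (intro radial_projection_Suc) (simp add: H_def)
    qed
    ultimately show ?thesis by simp
  qed
  ultimately show ?case by simp
qed

text \<open>Without a common zero, \<open>F\<close> would project to an odd map of the \<open>n\<close>-sphere to itself that avoids the
  pole and hence has degree \<open>0\<close>.\<close>

theorem Borsuk_Ulam_Lipschitz:
  assumes lip: "\<And>x y i. \<lbrakk>x \<in> unit_sphere n; y \<in> unit_sphere n; i < n\<rbrakk>
                  \<Longrightarrow> \<bar>F x i - F y i\<bar> \<le> L * l1_dist n x y"
    and odd: "\<And>x i. \<lbrakk>x \<in> unit_sphere n; i < n\<rbrakk> \<Longrightarrow> F (\<lambda>i. - x i) i = - F x i"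
  shows "\<exists>x\<in>unit_sphere n. \<forall>i<n. F x i = (0::real)"
proof (rule ccontr)
  assume contra: "\<not> ?thesis"
  define F' where "F' x i = (if i < n then F x i else 0)" for x i
  have nz: "\<exists>i\<le>n. F' x i \<noteq> 0" if "x \<in> unit_sphere n" for x
    using contra that by (auto simp: F'_def intro: less_imp_le)
  have lip': "\<bar>F' x i - F' y i\<bar> \<le> \<bar>L\<bar> * l1_dist n x y"
    if "x \<in> unit_sphere n" "y \<in> unit_sphere n" for x y i
  proof -
    have "L * l1_dist n x y \<le> \<bar>L\<bar> * l1_dist n x y"
      by (simp add: mult_right_mono l1_dist_nonneg)
    then show ?thesis
      using lip[OF that, of i] by (auto simp: F'_def l1_dist_nonneg)
  qed
  let ?f = "\<lambda>x. radial_projection n (F' x)"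
  have "odd (Brouwer_degree2 n ?f)"
    by (rule Borsuk_odd_degree_Lipschitz[of n F' "\<bar>L\<bar>"]) (use lip' nz odd in \<open>auto simp: F'_def\<close>)
  moreover have "Brouwer_degree2 n ?f = 0"
  proof (rule Brouwer_degree2_nonsurjective)
    show "continuous_map (nsphere n) (nsphere n) ?f"
    proof (rule continuous_map_radial_projection)
      show "continuous_map (nsphere n) euclideanreal (\<lambda>x. F' x i)" for i
        by (rule continuous_map_nsphere_Lipschitz[of _ _ "\<bar>L\<bar>"]) (use lip' in auto)
    qed (use nz in auto)
    define e :: "nat \<Rightarrow> real" where "e i = (if i = n then 1 else 0)" for i
    have "(\<Sum>i\<le>n. (e i)\<^sup>2) = (\<Sum>i\<le>n. if i = n then 1 else 0)"
      by (intro sum.cong) (auto simp: e_def)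
    then have "e \<in> unit_sphere n" by (simp add: nsphere) (simp add: e_def)
    moreover have "e \<notin> ?f ` unit_sphere n"
    proof
      assume "e \<in> ?f ` unit_sphere n"
      then obtain x where "e = ?f x" by blast
      then have "e n = 0" by (simp add: radial_projection_def F'_def)
      then show False by (simp add: e_def)
    qed
    ultimately show "?f ` unit_sphere n \<noteq> unit_sphere n" by blast
  qed
  ultimately show False by simp
qed

section \<open>The Lusternik-Schnirelmann theorem for arbitrary sets\<close>

text \<open>Borsuk-Ulam yields \<open>x\<close> such that, for each of the first \<open>n\<close> sets, \<open>x\<close> and \<open>-x\<close> have the same distance from
  it. If one of these sets contains \<open>x\<close> or \<open>-x\<close>, both distances are \<open>0\<close>;
  otherwise both points lie in the last set.\<close>

theorem Lusternik_Schnirelmann_approximate: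
  assumes cover: "unit_sphere n \<subseteq> (\<Union>i\<le>n. A i)" and "\<epsilon> > 0"
  obtains i a b x where "i \<le> n" "x \<in> unit_sphere n" "a \<in> A i" "b \<in> A i"
    "l1_dist n x a < \<epsilon>" "l1_dist n (\<lambda>j. - x j) b < \<epsilon>"
proof -
  define r where "r i x = (INF a\<in>A i. l1_dist n x a)" for i x
  have bdd: "bdd_below (l1_dist n x ` B)" for x B
    using l1_dist_nonneg by (intro bdd_belowI2[of _ 0]) auto
  have tri: "l1_dist n x z \<le> l1_dist n x y + l1_dist n y z" for x y z
    unfolding l1_dist_def sum.distrib[symmetric] by (intro sum_mono) linarith
  have sym: "l1_dist n x y = l1_dist n y x" for x y
    by (simp add: l1_dist_def abs_minus_commute)
  have r_le: "r i x \<le> r i y + l1_dist n x y" for i x y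
  proof (cases "A i = {}")
    case False
    have "r i x - l1_dist n x y \<le> r i y"
      unfolding r_def[of i y]
    proof (rule cINF_greatest[OF False])
      fix a assume "a \<in> A i"
      then have "r i x \<le> l1_dist n x a"
        unfolding r_def by (intro cINF_lower bdd)
      then show "r i x - l1_dist n x y \<le> l1_dist n y a"
        using tri[of x a y] by linarith
    qed
    then show ?thesis by linarith
  qed (simp add: r_def l1_dist_nonneg)
  have r_lip: "\<bar>r i x - r i y\<bar> \<le> l1_dist n x y" for i x y
    using r_le[of i x y] r_le[of i y x] sym[of x y] by linarith
  have near: "\<exists>a\<in>A i. l1_dist n x a < \<epsilon>" if "A i \<noteq> {}" "r i x \<le> 0" for i x
    using cINF_less_iff[OF that(1) bdd, of x \<epsilon>] that(2) \<open>\<epsilon> > 0\<close> by (simp add: r_def)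
  have r_self: "r i a \<le> 0" if "a \<in> A i" for i a
    using cINF_lower[OF bdd that, of a] by (simp add: r_def l1_dist_def)
  define F where "F x i = r i x - r i (\<lambda>j. - x j)" for x i
  have "\<exists>x\<in>unit_sphere n. \<forall>i<n. F x i = 0"
  proof (rule Borsuk_Ulam_Lipschitz[of n F 2])
    show "\<bar>F x i - F y i\<bar> \<le> 2 * l1_dist n x y" for x y i
    proof -
      have "l1_dist n (\<lambda>j. - x j) (\<lambda>j. - y j) = l1_dist n x y"
        by (simp add: l1_dist_def abs_minus_commute)
      then show ?thesis
        using r_lip[of i x y] r_lip[of i "\<lambda>j. - x j" "\<lambda>j. - y j"] by (simp add: F_def)
    qed
  qed (simp add: F_def)
  then obtain x where x: "x \<in> unit_sphere n" "\<And>i. i < n \<Longrightarrow> r i x = r i (\<lambda>j. - x j)"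
    by (auto simp: F_def)
  obtain i where i: "i \<le> n" "r i x \<le> 0" "r i (\<lambda>j. - x j) \<le> 0" "A i \<noteq> {}"
  proof (cases "\<exists>i<n. x \<in> A i \<or> (\<lambda>j. - x j) \<in> A i")
    case True
    then obtain i where i: "i < n" "x \<in> A i \<or> (\<lambda>j. - x j) \<in> A i" by blast
    have "r i x \<le> 0 \<and> r i (\<lambda>j. - x j) \<le> 0"
      using i(2) x(2)[OF i(1)] r_self[of x i] r_self[of "\<lambda>j. - x j" i] by auto
    moreover have "A i \<noteq> {}" using i(2) by blast
    ultimately show ?thesis using that[of i] i(1) by simp
  next
    case False
    obtain i j where "i \<le> n" "x \<in> A i" "j \<le> n" "(\<lambda>j. - x j) \<in> A j"
      using cover x(1) unit_sphere_uminus[OF x(1)] by blast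
    then have xn: "x \<in> A n" "(\<lambda>j. - x j) \<in> A n"
      using False by (metis le_neq_implies_less)+
    then have "A n \<noteq> {}" by blast
    then show ?thesis using that[of n] r_self[OF xn(1)] r_self[OF xn(2)] by simp
  qed
  obtain a b where "a \<in> A i" "l1_dist n x a < \<epsilon>" "b \<in> A i" "l1_dist n (\<lambda>j. - x j) b < \<epsilon>"
    using near[OF i(4) i(2)] near[OF i(4) i(3)] by blast
  then show ?thesis using that i(1) x(1) by blast
qed

section \<open>The geodesic metric\<close>

lemma abs_inner_le_L2_set: "\<bar>\<Sum>i\<le>n. x i * y i\<bar> \<le> L2_set x {..n} * L2_set y {..n}"
proof -
  have "\<bar>\<Sum>i\<le>n. x i * y i\<bar> \<le> (\<Sum>i\<le>n. \<bar>x i\<bar> * \<bar>y i\<bar>)"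
    unfolding abs_mult[symmetric] by (rule sum_abs)
  also have "\<dots> \<le> L2_set x {..n} * L2_set y {..n}"
    by (rule L2_set_mult_ineq)
  finally show ?thesis .
qed

lemma abs_inner_le_1:
  assumes "x \<in> unit_sphere n" "y \<in> unit_sphere n"
  shows "\<bar>\<Sum>i\<le>n. x i * y i\<bar> \<le> 1"
  using abs_inner_le_L2_set[of x y n] assms by (simp add: unit_sphere_eq)

lemma geodesic_bounds:
  assumes "x \<in> unit_sphere n" "y \<in> unit_sphere n"
  shows "0 \<le> geodesic n x y" "geodesic n x y \<le> pi"
  using abs_inner_le_1[OF assms] by (auto simp: geodesic_def abs_le_iff intro!: arccos_lbound arccos_ubound)

lemma geodesic_commute: "geodesic n x y = geodesic n y x"
  by (simp add: geodesic_def mult.commute)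

lemma geodesic_eq_0_iff:
  assumes x: "x \<in> unit_sphere n" and y: "y \<in> unit_sphere n"
  shows "geodesic n x y = 0 \<longleftrightarrow> x = y"
proof
  have xx: "(\<Sum>i\<le>n. (x i)\<^sup>2) = 1" "(\<Sum>i\<le>n. (y i)\<^sup>2) = 1"
    using x y by (auto simp: nsphere)
  show "geodesic n x y = 0" if "x = y"
    using xx that by (simp add: geodesic_def power2_eq_square)
  assume "geodesic n x y = 0"
  then have "cos (arccos (\<Sum>i\<le>n. x i * y i)) = 1"
    by (simp add: geodesic_def)
  then have "(\<Sum>i\<le>n. x i * y i) = 1"
    using abs_inner_le_1[OF x y] by (simp add: cos_arccos_abs)
  then have "(\<Sum>i\<le>n. (x i - y i)\<^sup>2) = 0"
    using xx by (simp add: power2_diff sum.distrib sum_subtractf mult.assoc flip: sum_distrib_left)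
  then have "x i = y i" if "i \<le> n" for i
    using that by (simp add: sum_nonneg_eq_0_iff)
  then show "x = y"
    using x y by (auto simp: nsphere fun_eq_iff) (metis not_le)
qed

text \<open>Let \<open>a\<close>, \<open>b\<close>, \<open>c\<close> be the inner products of \<open>x\<close> with \<open>y\<close>, of \<open>y\<close> with \<open>z\<close> and of \<open>x\<close> with \<open>z\<close>. The
  components of \<open>x\<close> and \<open>z\<close> orthogonal to \<open>y\<close> have inner product \<open>c - a * b\<close> and norms
  \<open>sqrt (1 - a\<^sup>2)\<close> and \<open>sqrt (1 - b\<^sup>2)\<close>. So the Cauchy-Schwarz inequality bounds \<open>c\<close> from below by
  the cosine of the sum of the two other distances.\<close>

lemma geodesic_triangle:
  assumes x: "x \<in> unit_sphere n" and y: "y \<in> unit_sphere n" and z: "z \<in> unit_sphere n"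
  shows "geodesic n x z \<le> geodesic n x y + geodesic n y z"
proof (cases "geodesic n x y + geodesic n y z \<le> pi")
  case True
  define a where "a = (\<Sum>i\<le>n. x i * y i)"
  define b where "b = (\<Sum>i\<le>n. y i * z i)"
  define c where "c = (\<Sum>i\<le>n. x i * z i)"
  have xx: "(\<Sum>i\<le>n. (x i)\<^sup>2) = 1" "(\<Sum>i\<le>n. (y i)\<^sup>2) = 1" "(\<Sum>i\<le>n. (z i)\<^sup>2) = 1"
    using x y z by (auto simp: nsphere)
  have bounds: "\<bar>a\<bar> \<le> 1" "\<bar>b\<bar> \<le> 1" "\<bar>c\<bar> \<le> 1"
    unfolding a_def b_def c_def using assms by (auto intro: abs_inner_le_1)
  have "(\<Sum>i\<le>n. (x i - a * y i)\<^sup>2) = (\<Sum>i\<le>n. (x i)\<^sup>2) - 2 * a * (\<Sum>i\<le>n. x i * y i) + a\<^sup>2 * (\<Sum>i\<le>n. (y i)\<^sup>2)"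
    unfolding sum_distrib_left sum_subtractf[symmetric] sum.distrib[symmetric]
    by (intro sum.cong) (auto simp: power2_eq_square algebra_simps)
  then have L1: "L2_set (\<lambda>i. x i - a * y i) {..n} = sqrt (1 - a\<^sup>2)"
    using xx by (simp add: L2_set_def a_def[symmetric] power2_eq_square)
  have "(\<Sum>i\<le>n. (z i - b * y i)\<^sup>2) = (\<Sum>i\<le>n. (z i)\<^sup>2) - 2 * b * (\<Sum>i\<le>n. y i * z i) + b\<^sup>2 * (\<Sum>i\<le>n. (y i)\<^sup>2)"
    unfolding sum_distrib_left sum_subtractf[symmetric] sum.distrib[symmetric]
    by (intro sum.cong) (auto simp: power2_eq_square algebra_simps)
  then have L2: "L2_set (\<lambda>i. z i - b * y i) {..n} = sqrt (1 - b\<^sup>2)"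
    using xx by (simp add: L2_set_def b_def[symmetric] power2_eq_square)
  have "(\<Sum>i\<le>n. (x i - a * y i) * (z i - b * y i)) =
      (\<Sum>i\<le>n. x i * z i) - b * (\<Sum>i\<le>n. x i * y i) - a * (\<Sum>i\<le>n. y i * z i) + a * b * (\<Sum>i\<le>n. (y i)\<^sup>2)"
    unfolding sum_distrib_left sum_subtractf[symmetric] sum.distrib[symmetric]
    by (intro sum.cong) (auto simp: power2_eq_square algebra_simps)
  then have "(\<Sum>i\<le>n. (x i - a * y i) * (z i - b * y i)) = c - a * b"
    using xx by (simp add: a_def[symmetric] b_def[symmetric] c_def[symmetric])
  then have "\<bar>c - a * b\<bar> \<le> sqrt (1 - a\<^sup>2) * sqrt (1 - b\<^sup>2)"
    using abs_inner_le_L2_set[of "\<lambda>i. x i - a * y i" "\<lambda>i. z i - b * y i" n] by (simp add: L1 L2)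
  moreover have "cos (arccos a + arccos b) = a * b - sqrt (1 - a\<^sup>2) * sqrt (1 - b\<^sup>2)"
    using bounds by (simp add: cos_add cos_arccos_abs sin_arccos_abs)
  ultimately have "cos (arccos a + arccos b) \<le> c" by linarith
  then have "arccos c \<le> arccos (cos (arccos a + arccos b))"
    using bounds by (intro arccos_le_arccos) auto
  also have "\<dots> = arccos a + arccos b"
  proof (rule arccos_cos)
    show "0 \<le> arccos a + arccos b"
      using bounds by (intro add_nonneg_nonneg arccos_lbound) auto
    show "arccos a + arccos b \<le> pi"
      using True by (simp add: geodesic_def a_def b_def)
  qed
  finally show ?thesis
    by (simp add: geodesic_def a_def b_def c_def)
next
  case False
  then show ?thesis using geodesic_bounds(2)[OF x z] by linarith
qed

lemma geodesic_eq_geodesic_of_smaller_sphere: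
  assumes "x \<in> unit_sphere m" "m \<le> n"
  shows "geodesic n x y = geodesic m x y"
proof -
  have "(\<Sum>i\<le>n. x i * y i) = (\<Sum>i\<le>m. x i * y i)"
    using assms by (intro sum.mono_neutral_right) (auto simp: nsphere)
  then show ?thesis by (simp add: geodesic_def)
qed

lemma inner_le_of_near_antipodal:
  assumes "x \<in> unit_sphere n" "a \<in> unit_sphere n" "b \<in> unit_sphere n"
  shows "(\<Sum>i\<le>n. a i * b i) \<le> l1_dist n x a + l1_dist n (\<lambda>i. - x i) b - 1"
proof -
  have "(\<Sum>i\<le>n. a i * b i) + (\<Sum>i\<le>n. (x i)\<^sup>2) \<le> l1_dist n x a + l1_dist n (\<lambda>i. - x i) b"
    unfolding l1_dist_def sum.distrib[symmetric]
  proof (rule sum_mono)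
    fix i
    have "\<bar>(a i - x i) * b i\<bar> \<le> \<bar>a i - x i\<bar> * 1"
      unfolding abs_mult using assms by (intro mult_left_mono unit_sphere_abs_le_1[of b n]) auto
    then have *: "(a i - x i) * b i \<le> \<bar>x i - a i\<bar>" by simp
    have "\<bar>x i * (b i + x i)\<bar> \<le> 1 * \<bar>b i + x i\<bar>"
      unfolding abs_mult using assms by (intro mult_right_mono unit_sphere_abs_le_1[of x n]) auto
    moreover have "\<bar>- x i - b i\<bar> = \<bar>b i + x i\<bar>" by linarith
    ultimately have "x i * (b i + x i) \<le> \<bar>- x i - b i\<bar>"
      by (metis abs_ge_self mult_1 order_trans)
    moreover have "a i * b i + (x i)\<^sup>2 = (a i - x i) * b i + x i * (b i + x i)"
      by (simp add: power2_eq_square algebra_simps)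
    ultimately show "a i * b i + (x i)\<^sup>2 \<le> \<bar>x i - a i\<bar> + \<bar>- x i - b i\<bar>"
      using * by linarith
  qed
  then show ?thesis
    using assms(1) by (simp add: nsphere)
qed

text \<open>The value of \<open>\<epsilon>\<close> makes the inner product of \<open>a\<close> and \<open>b\<close> smaller than
  \<open>2 * \<epsilon> - 1 = cos (pi - \<delta>)\<close>.\<close>

theorem Lusternik_Schnirelmann_geodesic:
  assumes cover: "unit_sphere n \<subseteq> (\<Union>i\<le>n. A i)" and sub: "\<And>i. A i \<subseteq> unit_sphere n"
    and "0 < \<delta>" "\<delta> \<le> pi"
  shows "\<exists>i\<le>n. \<exists>a\<in>A i. \<exists>b\<in>A i. pi - \<delta> < geodesic n a b"
proof -
  define \<epsilon> where "\<epsilon> = (1 - cos \<delta>) / 2"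
  have "cos \<delta> < cos 0"
    using assms by (intro cos_monotone_0_pi) auto
  then have "\<epsilon> > 0" by (simp add: \<epsilon>_def)
  from Lusternik_Schnirelmann_approximate[OF cover this]
  obtain i a b x where *: "i \<le> n" "x \<in> unit_sphere n" "a \<in> A i" "b \<in> A i"
    "l1_dist n x a < \<epsilon>" "l1_dist n (\<lambda>j. - x j) b < \<epsilon>"
    by metis
  then have ab: "a \<in> unit_sphere n" "b \<in> unit_sphere n"
    using sub by blast+
  have "(\<Sum>i\<le>n. a i * b i) < 2 * \<epsilon> - 1"
    using inner_le_of_near_antipodal[OF *(2) ab] *(5,6) by linarith
  also have "\<dots> = cos (pi - \<delta>)"
    by (simp add: \<epsilon>_def cos_diff field_simps)
  finally have "arccos (cos (pi - \<delta>)) < geodesic n a b"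
    unfolding geodesic_def using abs_inner_le_1[OF ab] by (intro arccos_less_arccos) auto
  then have "pi - \<delta> < geodesic n a b"
    using assms by (subst (asm) arccos_cos) auto
  with * show ?thesis by blast
qed

section \<open>The lower bound\<close>

text \<open>The infimum that defines the Gromov-Hausdorff distance has its intended meaning only for a nonempty
  set. A common ambient space is the larger sphere, of which the smaller one is a metric
  subspace.\<close>

lemma gromov_hausdorff_spheres_nonvacuous:
  assumes "m \<le> n"
  shows "\<exists>(Z :: ((nat \<Rightarrow> real) + (nat \<Rightarrow> real)) set) dZ f g. Metric_space Z dZ \<and>
           isometric_embedding (unit_sphere m) (geodesic m) Z dZ f \<and>
           isometric_embedding (unit_sphere n) (geodesic n) Z dZ g"
proof -
  let ?S = "unit_sphere n"
  \<comment> \<open>the locale demands symmetry and nonnegativity off the carrier, too, where \<^const>\<open>arccos\<close> may be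
    applied outside \<open>[-1, 1]\<close>\<close>
  define d where "d x y = (if x \<in> ?S \<and> y \<in> ?S then geodesic n x y else 0)" for x y
  have "Metric_space ?S d"
    by unfold_locales (auto simp: d_def geodesic_bounds geodesic_commute geodesic_eq_0_iff geodesic_triangle)
  moreover have "isometric_embedding (unit_sphere m) (geodesic m) ?S d id"
    using unit_sphere_mono[OF assms] geodesic_eq_geodesic_of_smaller_sphere[OF _ assms]
    by (auto simp: isometric_embedding_def d_def subset_iff)
  moreover have "isometric_embedding ?S (geodesic n) ?S d id"
    by (auto simp: isometric_embedding_def d_def)
  ultimately show ?thesis
    using gromov_hausdorff_ambient_space by blast
qed

text \<open>The bounds on \<open>d\<close> ensure that the suprema and infima in the definition exist.\<close>

lemma hausdorff_distance_lessD:
  assumes bound: "\<And>a b. \<lbrakk>a \<in> A; b \<in> B\<rbrakk> \<Longrightarrow> 0 \<le> d a b \<and> d a b \<le> M"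
    and less: "hausdorff_distance d A B < r"
  shows "\<lbrakk>a \<in> A; B \<noteq> {}\<rbrakk> \<Longrightarrow> \<exists>b\<in>B. d a b < r"
    and "\<lbrakk>b \<in> B; A \<noteq> {}\<rbrakk> \<Longrightarrow> \<exists>a\<in>A. d a b < r"
proof -
  have bdd1: "bdd_below (d a ` B)" if "a \<in> A" for a
    using bound that by (intro bdd_belowI2[of _ 0]) auto
  have bdd2: "bdd_below ((\<lambda>a. d a b) ` A)" if "b \<in> B" for b
    using bound that by (intro bdd_belowI2[of _ 0]) auto
  show "\<exists>b\<in>B. d a b < r" if a: "a \<in> A" and B: "B \<noteq> {}"
  proof -
    have "bdd_above ((\<lambda>a. INF b\<in>B. d a b) ` A)"
    proof (rule bdd_aboveI2[of _ _ M])
      fix a assume a: "a \<in> A"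
      obtain b where b: "b \<in> B" using B by blast
      show "(INF b\<in>B. d a b) \<le> M"
        using cINF_lower[OF bdd1[OF a] b] bound[OF a b] by linarith
    qed
    then have "(INF b\<in>B. d a b) \<le> (SUP a\<in>A. INF b\<in>B. d a b)"
      by (intro cSUP_upper a)
    then have "(INF b\<in>B. d a b) < r"
      using less by (simp add: hausdorff_distance_def)
    then show ?thesis
      using cINF_less_iff[OF B bdd1[OF a]] by blast
  qed
  show "\<exists>a\<in>A. d a b < r" if b: "b \<in> B" and A: "A \<noteq> {}"
  proof -
    have "bdd_above ((\<lambda>b. INF a\<in>A. d a b) ` B)"
    proof (rule bdd_aboveI2[of _ _ M])
      fix b assume b: "b \<in> B"
      obtain a where a: "a \<in> A" using A by blast
      show "(INF a\<in>A. d a b) \<le> M"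
        using cINF_lower[OF bdd2[OF b] a] bound[OF a b] by linarith
    qed
    then have "(INF a\<in>A. d a b) \<le> (SUP b\<in>B. INF a\<in>A. d a b)"
      by (intro cSUP_upper b)
    then have "(INF a\<in>A. d a b) < r"
      using less by (simp add: hausdorff_distance_def)
    then show ?thesis
      using cINF_less_iff[OF A bdd2[OF b]] by blast
  qed
qed

text \<open>If the inequality failed, points of a common class \<open>A i\<close> would be at distance less than
  \<open>2 * (H + \<delta>) + 2 * (r + \<delta>) \<le> pi - 2 * \<delta>\<close>, against the Lusternik-Schnirelmann theorem.\<close>

lemma hausdorff_distance_spheres_ge:
  assumes Z: "Metric_space Z dZ"
    and f: "isometric_embedding (unit_sphere m) (geodesic m) Z dZ f"
    and g: "isometric_embedding (unit_sphere n) (geodesic n) Z dZ g"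
    and P: "P \<subseteq> unit_sphere m" "P \<noteq> {}" "finite P" "card P \<le> n + 1"
  shows "pi / 2 - hausdorff_distance (geodesic m) (unit_sphere m) P
           \<le> hausdorff_distance dZ (f ` unit_sphere m) (g ` unit_sphere n)"
proof (rule ccontr)
  interpret Z: Metric_space Z dZ by (rule Z)
  let ?X = "unit_sphere m" and ?Y = "unit_sphere n"
  define H where "H = hausdorff_distance dZ (f ` ?X) (g ` ?Y)"
  define r where "r = hausdorff_distance (geodesic m) ?X P"
  assume "\<not> ?thesis"
  then have gap: "H + r < pi / 2" by (simp add: H_def r_def)
  \<comment> \<open>a third of the gap leaves room for the three errors \<open>2 * \<delta>\<close> on the scale of \<open>pi\<close>; the cap
    \<open>1\<close> keeps \<open>2 * \<delta>\<close> below \<open>pi\<close>\<close>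
  define \<delta> where "\<delta> = min 1 ((pi / 2 - H - r) / 3)"
  have \<delta>: "\<delta> > 0" "\<delta> \<le> 1" "3 * \<delta> \<le> pi / 2 - H - r"
    using gap by (auto simp: \<delta>_def min_def)
  have fZ: "f x \<in> Z" if "x \<in> ?X" for x using f that by (auto simp: isometric_embedding_def)
  have gZ: "g y \<in> Z" if "y \<in> ?Y" for y using g that by (auto simp: isometric_embedding_def)
  have df: "dZ (f x) (f x') = geodesic m x x'" if "x \<in> ?X" "x' \<in> ?X" for x x'
    using f that by (auto simp: isometric_embedding_def)
  have dg: "dZ (g y) (g y') = geodesic n y y'" if "y \<in> ?Y" "y' \<in> ?Y" for y y'
    using g that by (auto simp: isometric_embedding_def)
  obtain x0 where x0: "x0 \<in> ?X" using in_topspace_nsphere by blast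
  obtain y0 where y0: "y0 \<in> ?Y" using in_topspace_nsphere by blast
  have bound: "0 \<le> dZ a b \<and> dZ a b \<le> pi + dZ (f x0) (g y0) + pi"
    if ab: "a \<in> f ` ?X" "b \<in> g ` ?Y" for a b
  proof -
    obtain x y where xy: "a = f x" "x \<in> ?X" "b = g y" "y \<in> ?Y" using ab by blast
    have "dZ (f x) (g y) \<le> dZ (f x) (f x0) + dZ (f x0) (g y)"
      using xy x0 fZ gZ by (intro Z.triangle) auto
    also have "dZ (f x0) (g y) \<le> dZ (f x0) (g y0) + dZ (g y0) (g y)"
      using xy x0 y0 fZ gZ by (intro Z.triangle) auto
    finally show ?thesis
      using geodesic_bounds(2)[OF xy(2) x0] geodesic_bounds(2)[OF y0 xy(4)] xy x0 y0
      by (simp add: df dg)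
  qed
  have "\<exists>x\<in>?X. dZ (f x) (g y) < H + \<delta>" if "y \<in> ?Y" for y
  proof -
    have "\<exists>a\<in>f ` ?X. dZ a (g y) < H + \<delta>"
    proof (rule hausdorff_distance_lessD(2))
      show "hausdorff_distance dZ (f ` ?X) (g ` ?Y) < H + \<delta>" using \<delta>(1) by (simp add: H_def)
      show "0 \<le> dZ a b \<and> dZ a b \<le> pi + dZ (f x0) (g y0) + pi"
        if "a \<in> f ` ?X" "b \<in> g ` ?Y" for a b
        using bound[OF that] .
    qed (use that x0 in auto)
    then show ?thesis by blast
  qed
  then obtain \<phi> where \<phi>: "\<And>y. y \<in> ?Y \<Longrightarrow> \<phi> y \<in> ?X" "\<And>y. y \<in> ?Y \<Longrightarrow> dZ (f (\<phi> y)) (g y) < H + \<delta>"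
    by metis
  have near: "\<exists>p\<in>P. geodesic m x p < r + \<delta>" if "x \<in> ?X" for x
  proof (rule hausdorff_distance_lessD(1)[OF _ _ that P(2)])
    show "hausdorff_distance (geodesic m) ?X P < r + \<delta>" using \<delta>(1) by (simp add: r_def)
    show "0 \<le> geodesic m a b \<and> geodesic m a b \<le> pi" if "a \<in> ?X" "b \<in> P" for a b
      using geodesic_bounds[of a m b] that P(1) by auto
  qed
  obtain e where e: "bij_betw e {0..<card P} P"
    using ex_bij_betw_nat_finite[OF P(3)] by blast
  \<comment> \<open>\<open>P\<close> may have fewer than \<open>n + 1\<close> points; the surplus classes are empty\<close>
  define A where "A i = {y \<in> ?Y. i < card P \<and> geodesic m (\<phi> y) (e i) < r + \<delta>}" for i
  have "?Y \<subseteq> (\<Union>i\<le>n. A i)"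
  proof
    fix y assume y: "y \<in> ?Y"
    obtain p where p: "p \<in> P" "geodesic m (\<phi> y) p < r + \<delta>" using near \<phi>(1)[OF y] by blast
    obtain i where "i < card P" "p = e i"
      using p(1) e by (force simp: bij_betw_def)
    then show "y \<in> (\<Union>i\<le>n. A i)" using y p P(4) by (auto simp: A_def intro!: bexI[of _ i])
  qed
  moreover have "2 * \<delta> \<le> pi" using \<delta>(2) pi_gt3 by linarith
  ultimately obtain i a b where ab: "a \<in> A i" "b \<in> A i" "pi - 2 * \<delta> < geodesic n a b"
    using Lusternik_Schnirelmann_geodesic[of n A "2 * \<delta>"] \<delta>(1) by (auto simp: A_def)
  then have aY: "a \<in> ?Y" "b \<in> ?Y" and i: "i < card P" by (auto simp: A_def)
  have ei: "e i \<in> ?X" using e i P(1) by (auto simp: bij_betw_def)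
  have "geodesic n a b = dZ (g a) (g b)" using dg aY by simp
  also have "\<dots> \<le> dZ (g a) (f (\<phi> a)) + dZ (f (\<phi> a)) (g b)"
    using fZ gZ \<phi> aY by (intro Z.triangle) auto
  also have "dZ (f (\<phi> a)) (g b) \<le> dZ (f (\<phi> a)) (f (\<phi> b)) + dZ (f (\<phi> b)) (g b)"
    using fZ gZ \<phi> aY by (intro Z.triangle) auto
  also have "dZ (f (\<phi> a)) (f (\<phi> b)) = geodesic m (\<phi> a) (\<phi> b)"
    using df \<phi> aY by simp
  also have "\<dots> \<le> geodesic m (\<phi> a) (e i) + geodesic m (e i) (\<phi> b)"
    using \<phi> aY ei by (intro geodesic_triangle) auto
  finally have "geodesic n a b \<le> dZ (f (\<phi> a)) (g a) + dZ (f (\<phi> b)) (g b)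
      + geodesic m (\<phi> a) (e i) + geodesic m (\<phi> b) (e i)"
    using Z.commute[of "g a"] geodesic_commute[of m "e i"] by simp
  also have "\<dots> < 2 * (H + \<delta>) + 2 * (r + \<delta>)"
    using \<phi>(2)[OF aY(1)] \<phi>(2)[OF aY(2)] ab by (simp add: A_def)
  also have "\<dots> \<le> pi - 2 * \<delta>"
    using \<delta>(3) by (simp add: field_simps)
  finally show False
    using ab(3) by simp
qed

theorem proposition1p8:
  fixes m n :: nat
  assumes "1 \<le> m" and "m < n"
  shows "gromov_hausdorff (unit_sphere m) (geodesic m) (unit_sphere n) (geodesic n)
           \<ge> pi / 2 - covering_radius (unit_sphere m) (geodesic m) (n + 1)"
  unfolding gromov_hausdorff_def
proof (rule cInf_greatest)
  let ?X = "unit_sphere m" and ?Y = "unit_sphere n"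
  show "{hausdorff_distance dZ (f ` ?X) (g ` ?Y) | (Z :: ((nat \<Rightarrow> real) + (nat \<Rightarrow> real)) set) dZ f g.
          Metric_space Z dZ \<and> isometric_embedding ?X (geodesic m) Z dZ f \<and>
          isometric_embedding ?Y (geodesic n) Z dZ g} \<noteq> {}"
    using gromov_hausdorff_spheres_nonvacuous[OF less_imp_le[OF assms(2)]] by blast
  fix h
  assume "h \<in> {hausdorff_distance dZ (f ` ?X) (g ` ?Y) | (Z :: ((nat \<Rightarrow> real) + (nat \<Rightarrow> real)) set) dZ f g.
          Metric_space Z dZ \<and> isometric_embedding ?X (geodesic m) Z dZ f \<and>
          isometric_embedding ?Y (geodesic n) Z dZ g}"
  then obtain Z :: "((nat \<Rightarrow> real) + (nat \<Rightarrow> real)) set" and dZ f g where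
    Z: "Metric_space Z dZ" "isometric_embedding ?X (geodesic m) Z dZ f"
       "isometric_embedding ?Y (geodesic n) Z dZ g"
    and h: "h = hausdorff_distance dZ (f ` ?X) (g ` ?Y)"
    by blast
  have "pi / 2 - h \<le> covering_radius ?X (geodesic m) (n + 1)"
    unfolding covering_radius_def
  proof (rule cInf_greatest)
    obtain x where "x \<in> ?X" using in_topspace_nsphere by blast
    then show "{hausdorff_distance (geodesic m) ?X P | P. P \<subseteq> ?X \<and> P \<noteq> {} \<and> finite P \<and> card P \<le> n + 1} \<noteq> {}"
      by (auto intro!: exI[of _ "{x}"])
    fix r
    assume "r \<in> {hausdorff_distance (geodesic m) ?X P | P. P \<subseteq> ?X \<and> P \<noteq> {} \<and> finite P \<and> card P \<le> n + 1}"
    then obtain P where "r = hausdorff_distance (geodesic m) ?X P"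
      "P \<subseteq> ?X" "P \<noteq> {}" "finite P" "card P \<le> n + 1" by blast
    then show "pi / 2 - h \<le> r"
      using hausdorff_distance_spheres_ge[OF Z, of P] h by simp
  qed
  then show "pi / 2 - covering_radius ?X (geodesic m) (n + 1) \<le> h"
    by linarith
qed

end
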